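(* Up to permuting the indices $1,2,3$, there are exactly three codes $\mathcal{C}\subseteq 2^{\{1,2,3\}}$ that are convex but not box-convex, namely $$\mathcal{C}_1 = \{123, 12, 13, 23, \emptyset\},$$ $$\mathcal{C}_2 = \{123, 12, 13, 23, 1, \emptyset\},$$ $$\mathcal{C}_3 = \{12, 13, 23, 1, 2, 3, \emptyset\}.$$ That is, each of $\mathcal{C}_1,\mathcal{C}_2,\mathcal{C}_3$ is convex and not box-convex, and every convex code $\mathcal{C}\subseteq 2^{\{1,2,3\}}$ that is not box-convex is obtained from one of them by a permutation of $\{1,2,3\}$.
   Context: Write $[n]=\{1,\ldots,n\}$. A code is a set $\mathcal{C}\subseteq 2^{[n]}$; subsets of $[n]$ are abbreviated by listing their elements, e.g. $12=\{1,2\}$. For an ordered (indexed) collection $\mathcal{U} = \{U_1, \ldots, U_n\}$ of sets in $\mathbb{R}^d$, its code is $$\operatorname{code}(\mathcal{U}) = \{\sigma\subseteq [n] \mid \text{there exists } p\in \mathbb{R}^d \text{ such that for all } i\in[n],\ p\in U_i \text{ if and only if } i\in\sigma\},$$ and $\mathcal{U}$ is called a realization of $\operatorname{code}(\mathcal{U})$. By standing convention, all sets in realizations are bounded (so every realizable code contains $\emptyset$), and $d\geq 1$. A code is convex if it is open convex or closed convex, i.e. if for some $d$ it has a realization in $\mathbb{R}^d$ in which every set is open and convex, or one in which every set is closed and convex. An axis-parallel box (box for short) in $\mathbb{R}^d$ is either the empty set or a product $[a_1,b_1]\times\cdots\times[a_d,b_d]$ of nonempty closed intervals (degenerate intervals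 $a_i=b_i$ allowed). A code is box-convex if, for some $d$, it has a realization in $\mathbb{R}^d$ in which every set is a box. *)

theory Defs
  imports "HOL-Analysis.Analysis"
begin

text \<open>
  Convexity of a code quantifies existentially over the dimension \<open>d\<close>, so \<open>\<real>\<^sup>d\<close> cannot be a
  type here. It is rendered by the library topology \<^const>\<open>Euclidean_space\<close> \<open>d\<close> on
  \<^typ>\<open>nat \<Rightarrow> real\<close>: its points are the functions vanishing at all \<open>i \<ge> d\<close>, and the
  coordinates are the values at \<open>i < d\<close>. There is no vector space instance on
  \<^typ>\<open>nat \<Rightarrow> real\<close>, and its \<^class>\<open>metric_space\<close> instance is not the Euclidean metric; hence
  convexity and boundedness are spelled out, following the library's \<open>convex_def\<close> and
  \<open>bounded_iff\<close>.
\<close>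

definition convex_fun :: "(nat \<Rightarrow> real) set \<Rightarrow> bool" where
  "convex_fun S \<longleftrightarrow>
     (\<forall>x\<in>S. \<forall>y\<in>S. \<forall>u\<ge>0. \<forall>v\<ge>0. u + v = 1 \<longrightarrow> (\<lambda>i. u * x i + v * y i) \<in> S)"

definition bounded_fun :: "nat \<Rightarrow> (nat \<Rightarrow> real) set \<Rightarrow> bool" where
  "bounded_fun d S \<longleftrightarrow> (\<exists>B. \<forall>x\<in>S. L2_set x {..<d} \<le> B)"

definition axis_box :: "nat \<Rightarrow> (nat \<Rightarrow> real) set \<Rightarrow> bool" where
  "axis_box d S \<longleftrightarrow> S = {} \<or>
     (\<exists>a b. (\<forall>i<d. a i \<le> b i) \<and>
            S = {x \<in> topspace (Euclidean_space d). \<forall>i<d. x i \<in> {a i..b i}})"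

definition code_of :: "nat \<Rightarrow> nat \<Rightarrow> (nat \<Rightarrow> (nat \<Rightarrow> real) set) \<Rightarrow> nat set set" where
  "code_of n d U =
     {\<sigma>. \<sigma> \<subseteq> {1..n} \<and>
         (\<exists>p \<in> topspace (Euclidean_space d). \<forall>i\<in>{1..n}. p \<in> U i \<longleftrightarrow> i \<in> \<sigma>)}"

definition realization ::
  "nat \<Rightarrow> nat \<Rightarrow> (nat \<Rightarrow> (nat \<Rightarrow> real) set) \<Rightarrow> nat set set \<Rightarrow> bool" where
  "realization n d U C \<longleftrightarrow>
     d \<ge> 1 \<and>
     (\<forall>i\<in>{1..n}. U i \<subseteq> topspace (Euclidean_space d) \<and> bounded_fun d (U i)) \<and>
     code_of n d U = C"

definition open_convex_code :: "nat \<Rightarrow> nat set set \<Rightarrow> bool" where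
  "open_convex_code n C \<longleftrightarrow>
     (\<exists>d U. realization n d U C \<and>
            (\<forall>i\<in>{1..n}. openin (Euclidean_space d) (U i) \<and> convex_fun (U i)))"

definition closed_convex_code :: "nat \<Rightarrow> nat set set \<Rightarrow> bool" where
  "closed_convex_code n C \<longleftrightarrow>
     (\<exists>d U. realization n d U C \<and>
            (\<forall>i\<in>{1..n}. closedin (Euclidean_space d) (U i) \<and> convex_fun (U i)))"

definition convex_code :: "nat \<Rightarrow> nat set set \<Rightarrow> bool" where
  "convex_code n C \<longleftrightarrow> open_convex_code n C \<or> closed_convex_code n C"

definition box_convex_code :: "nat \<Rightarrow> nat set set \<Rightarrow> bool" where
  "box_convex_code n C \<longleftrightarrow>
     (\<exists>d U. realization n d U C \<and> (\<forall>i\<in>{1..n}. axis_box d (U i)))"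

definition perm_equiv :: "nat \<Rightarrow> nat set set \<Rightarrow> nat set set \<Rightarrow> bool" where
  "perm_equiv n C D \<longleftrightarrow> (\<exists>\<pi>. \<pi> permutes {1..n} \<and> D = (\<lambda>\<sigma>. \<pi> ` \<sigma>) ` C)"

definition C1 :: "nat set set" where
  "C1 = {{1,2,3}, {1,2}, {1,3}, {2,3}, {}}"

definition C2 :: "nat set set" where
  "C2 = {{1,2,3}, {1,2}, {1,3}, {2,3}, {1}, {}}"

definition C3 :: "nat set set" where
  "C3 = {{1,2}, {1,3}, {2,3}, {1}, {2}, {3}, {}}"

end

theory Submission
  imports Defs
begin

text \<open>
  If \<open>123 \<notin> C\<close> but \<open>12, 13 \<in> C\<close>, connectedness of \<open>U\<^sub>1\<close> forces \<open>1 \<in> C\<close>; this excludes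
  all nonconvex codes. Boxes have Helly number two, which rules out \<open>C\<^sub>3\<close>; and if two boxes are
  each covered by the other two, then a coordinate in which all three pairwise intersections are
  told apart yields a contradiction between three intervals, which rules out \<open>C\<^sub>1\<close> and \<open>C\<^sub>2\<close>.
  Conversely, thickening some of the boxes in an extra dimension adds the words \<open>\<sigma> \<inter> S\<close> to a
  box-convex code, and a similar step adds any singleton. So only codes with few singletons need
  a realization, and for those intervals on a line suffice.
\<close>

section \<open>Codes of realizations\<close>

lemma topspace_Euclidean_space_iff:
  "x \<in> topspace (Euclidean_space d) \<longleftrightarrow> (\<forall>i\<ge>d. x i = 0)"
  by (simp add: topspace_Euclidean_space)

text \<open>Every point determines exactly one word, so a code can be computed as the image of a
  word function on points.\<close>

lemma code_of_eq_image:
  "code_of n d U = (\<lambda>p. {i \<in> {1..n}. p \<in> U i}) ` topspace (Euclidean_space d)"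
proof -
  have "\<sigma> = {i \<in> {1..n}. p \<in> U i} \<longleftrightarrow> \<sigma> \<subseteq> {1..n} \<and> (\<forall>i\<in>{1..n}. p \<in> U i \<longleftrightarrow> i \<in> \<sigma>)" for \<sigma> p
    by blast
  then show ?thesis
    unfolding code_of_def image_def by simp
qed

lemma empty_in_realization:
  assumes "realization n d U C"
  shows "{} \<in> C"
proof -
  have d: "d \<ge> 1" and C: "C = code_of n d U"
    and "\<forall>i\<in>{1..n}. \<exists>B. \<forall>x\<in>U i. L2_set x {..<d} \<le> B"
    using assms by (auto simp: realization_def bounded_fun_def)
  then obtain B where B: "\<And>i x. i \<in> {1..n} \<Longrightarrow> x \<in> U i \<Longrightarrow> L2_set x {..<d} \<le> B i"
    by metis
  \<comment> \<open>A point on the first axis, available because \<open>d \<ge> 1\<close>, farther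
    out than the sum of all \<open>\<bar>B i\<bar>\<close> and hence beyond every single
    bound.\<close>
  define p where "p = (\<lambda>k::nat. if k = 0 then (\<Sum>i=1..n. \<bar>B i\<bar>) + 1 else 0)"
  have p: "p \<in> topspace (Euclidean_space d)"
    using d by (auto simp: p_def topspace_Euclidean_space_iff)
  have "p \<notin> U i" if i: "i \<in> {1..n}" for i
  proof
    assume "p \<in> U i"
    then have "L2_set p {..<d} \<le> B i"
      using B i by blast
    moreover have "p 0 \<le> L2_set p {..<d}"
      using d by (intro member_le_L2_set) auto
    moreover have "\<bar>B i\<bar> \<le> (\<Sum>i=1..n. \<bar>B i\<bar>)"
      using i by (intro member_le_sum) auto
    ultimately show False
      by (simp add: p_def)
  qed
  then have "{i \<in> {1..n}. p \<in> U i} = {}"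
    by blast
  then show ?thesis
    using p unfolding C code_of_eq_image by (metis (no_types, lifting) imageI)
qed

lemma empty_in_convex_code: "convex_code n C \<Longrightarrow> {} \<in> C"
  unfolding convex_code_def open_convex_code_def closed_convex_code_def
  using empty_in_realization by blast

text \<open>Taking images under an injection is itself injective. Cardinality is the invariant that
  tells \<open>C1\<close>, \<open>C2\<close> and \<open>C3\<close> apart.\<close>

lemma perm_equiv_card:
  assumes "perm_equiv n C D"
  shows "card D = card C"
proof -
  obtain \<pi> where \<pi>: "\<pi> permutes {1..n}" and D: "D = (`) \<pi> ` C"
    using assms by (auto simp: perm_equiv_def)
  have "inj_on ((`) \<pi>) C"
    using permutes_inj[OF \<pi>] by (auto simp: inj_on_def inj_image_eq_iff)
  then show ?thesis
    unfolding D by (rule card_image)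
qed

section \<open>Connectedness obstruction\<close>

lemma connectedin_segment_Euclidean_space:
  assumes "p \<in> topspace (Euclidean_space d)" "q \<in> topspace (Euclidean_space d)"
  shows "connectedin (Euclidean_space d) ((\<lambda>t k. (1 - t) * p k + t * q k) ` {0..1})"
proof (rule connectedin_continuous_map_image)
  show "continuous_map (top_of_set {0..1}) (Euclidean_space d) (\<lambda>t k. (1 - t) * p k + t * q k)"
    using assms
    by (auto simp: Euclidean_space_def continuous_map_in_subtopology
        continuous_map_componentwise_UNIV topspace_Euclidean_space_iff
        intro!: continuous_intros)
  show "connectedin (top_of_set {0..1::real}) {0..1}"
    by (simp add: connectedin_subtopology)
qed

text \<open>A segment in \<open>A\<close> from a point of \<open>B\<close> to a point of
  \<open>C\<close> would be disconnected by \<open>B\<close> and \<open>C\<close>. The disjunctive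
  hypothesis lets the same argument serve open and closed realizations.\<close>

lemma convex_fun_not_disjoint_union:
  assumes "convex_fun A" "A \<subseteq> topspace (Euclidean_space d)"
    and "openin (Euclidean_space d) B \<and> openin (Euclidean_space d) C
      \<or> closedin (Euclidean_space d) B \<and> closedin (Euclidean_space d) C"
    and "A \<inter> B \<inter> C = {}" "A \<inter> B \<noteq> {}" "A \<inter> C \<noteq> {}"
  shows "\<not> A \<subseteq> B \<union> C"
proof
  assume cover: "A \<subseteq> B \<union> C"
  obtain p q where p: "p \<in> A" "p \<in> B" and q: "q \<in> A" "q \<in> C"
    using assms by blast
  define S where "S = (\<lambda>t k. (1 - t) * p k + t * q k) ` {0..1::real}"
  have conn: "connectedin (Euclidean_space d) S"
    unfolding S_def using p q assms(2) by (intro connectedin_segment_Euclidean_space) auto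
  have SA: "S \<subseteq> A"
    using assms(1) p q unfolding S_def convex_fun_def by auto
  have "p \<in> S"
    unfolding S_def by (rule image_eqI[of _ _ 0]) auto
  moreover have "q \<in> S"
    unfolding S_def by (rule image_eqI[of _ _ 1]) auto
  ultimately have "B \<inter> S \<noteq> {}" "C \<inter> S \<noteq> {}" "S \<subseteq> B \<union> C" "B \<inter> C \<inter> S = {}"
    using p q SA cover assms(4) by auto
  with conn assms(3) show False
    by (metis connectedin connectedin_closedin)
qed

text \<open>If \<open>{i}\<close> is missing, \<open>U j\<close> and \<open>U k\<close> cover
  \<open>U i\<close>. Both meet it, and since \<open>{i, j, k}\<close> is missing they are disjoint
  inside it, contradicting connectedness.\<close>

lemma convex_code_mandatory_vertex:
  assumes "convex_code n C" and ijk: "{1..n} = {i, j, k}" "i \<noteq> j" "i \<noteq> k" "j \<noteq> k"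
    and "{i, j} \<in> C" "{i, k} \<in> C" "{i, j, k} \<notin> C"
  shows "{i} \<in> C"
proof (rule ccontr)
  assume "{i} \<notin> C"
  obtain d U where U: "realization n d U C" and conv: "\<forall>m\<in>{1..n}. convex_fun (U m)"
    and top: "(\<forall>m\<in>{1..n}. openin (Euclidean_space d) (U m)) \<or>
      (\<forall>m\<in>{1..n}. closedin (Euclidean_space d) (U m))"
    using assms(1) unfolding convex_code_def open_convex_code_def closed_convex_code_def by blast
  have sub: "\<forall>m\<in>{1..n}. U m \<subseteq> topspace (Euclidean_space d)" and C: "C = code_of n d U"
    using U by (auto simp: realization_def)
  have word: "\<sigma> \<in> C \<longleftrightarrow> (\<exists>p \<in> topspace (Euclidean_space d).
      (p \<in> U i \<longleftrightarrow> i \<in> \<sigma>) \<and> (p \<in> U j \<longleftrightarrow> j \<in> \<sigma>) \<and> (p \<in> U k \<longleftrightarrow> k \<in> \<sigma>))"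
    if "\<sigma> \<subseteq> {i, j, k}" for \<sigma>
    using that unfolding C code_of_def ijk(1) by simp
  have Ui: "U i \<subseteq> topspace (Euclidean_space d)"
    using sub ijk(1) by simp
  have "U i \<inter> U j \<inter> U k = {}"
    using word[of "{i, j, k}"] assms(8) Ui by auto
  moreover have "U i \<inter> U j \<noteq> {}" "U i \<inter> U k \<noteq> {}"
    using word[of "{i, j}"] word[of "{i, k}"] assms(6,7) by auto
  moreover have "U i \<subseteq> U j \<union> U k"
    using word[of "{i}"] \<open>{i} \<notin> C\<close> ijk(2-4) Ui by auto
  moreover have "convex_fun (U i)"
    using conv ijk(1) by simp
  moreover have "openin (Euclidean_space d) (U j) \<and> openin (Euclidean_space d) (U k)
      \<or> closedin (Euclidean_space d) (U j) \<and> closedin (Euclidean_space d) (U k)"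
    using top unfolding ijk(1) by blast
  ultimately show False
    using convex_fun_not_disjoint_union[OF _ Ui] by blast
qed

section \<open>Planar realizations\<close>

text \<open>Transfers figures in \<open>real \<times> real\<close>, where the library notions of
  compactness and convexity apply, by pulling them back along the first two coordinates. Compactness
  supplies both closedness and boundedness.\<close>

lemma closed_convex_code_planar:
  fixes S :: "nat \<Rightarrow> (real \<times> real) set"
  assumes "\<And>i. i \<in> {1..n} \<Longrightarrow> compact (S i) \<and> convex (S i)"
  shows "closed_convex_code n (range (\<lambda>q. {i \<in> {1..n}. q \<in> S i}))"
proof -
  define U where "U i = {x \<in> topspace (Euclidean_space 2). (x 0, x 1) \<in> S i}" for i
  have "continuous_map (Euclidean_space 2) euclidean (\<lambda>x. (x 0 :: real, x 1 :: real))"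
    unfolding prod_topology_euclidean[symmetric] continuous_map_pairwise o_def Euclidean_space_def
    by (auto intro!: continuous_map_from_subtopology continuous_map_product_projection)
  then have closed: "closedin (Euclidean_space 2) (U i)" if "i \<in> {1..n}" for i
    unfolding U_def using assms[OF that]
    by (intro closedin_continuous_map_preimage) (auto simp: compact_imp_closed)
  have convex: "convex_fun (U i)" if "i \<in> {1..n}" for i
    unfolding convex_fun_def
  proof (intro ballI allI impI)
    fix x y and u v :: real
    assume xy: "x \<in> U i" "y \<in> U i" and uv: "0 \<le> u" "0 \<le> v" "u + v = 1"
    then have "u *\<^sub>R (x 0, x 1) + v *\<^sub>R (y 0, y 1) \<in> S i"
      using assms[OF that] by (intro convexD) (auto simp: U_def)
    then show "(\<lambda>k. u * x k + v * y k) \<in> U i"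
      using xy by (auto simp: U_def topspace_Euclidean_space_iff)
  qed
  have bounded: "bounded_fun 2 (U i)" if "i \<in> {1..n}" for i
  proof -
    have "bounded (S i)"
      using assms[OF that] compact_imp_bounded by blast
    then obtain B where "\<forall>z\<in>S i. norm z \<le> B"
      unfolding bounded_iff by blast
    then have "\<forall>x\<in>U i. L2_set x {..<2} \<le> B"
      by (auto simp: U_def L2_set_def norm_Pair numeral_2_eq_2)
    then show ?thesis
      by (auto simp: bounded_fun_def)
  qed
  have code: "code_of n 2 U = range (\<lambda>q. {i \<in> {1..n}. q \<in> S i})"
  proof -
    have "range (\<lambda>q. {i \<in> {1..n}. q \<in> S i}) =
        (\<lambda>p. {i \<in> {1..n}. (p 0, p 1) \<in> S i}) ` topspace (Euclidean_space 2)"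
    proof (intro subset_antisym image_subsetI)
      fix q :: "real \<times> real"
      define p where "p = (\<lambda>k::nat. if k = 0 then fst q else if k = 1 then snd q else 0)"
      have "p \<in> topspace (Euclidean_space 2)"
        by (auto simp: p_def topspace_Euclidean_space_iff)
      moreover have "{i \<in> {1..n}. q \<in> S i} = {i \<in> {1..n}. (p 0, p 1) \<in> S i}"
        by (simp add: p_def)
      ultimately show "{i \<in> {1..n}. q \<in> S i} \<in>
          (\<lambda>p. {i \<in> {1..n}. (p 0, p 1) \<in> S i}) ` topspace (Euclidean_space 2)"
        unfolding image_iff by blast
    qed blast
    then show ?thesis
      unfolding code_of_eq_image by (auto simp: U_def)
  qed
  have "realization n 2 U (range (\<lambda>q. {i \<in> {1..n}. q \<in> S i}))"
    using bounded code by (auto simp: realization_def U_def)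
  then show ?thesis
    using closed convex unfolding closed_convex_code_def by blast
qed

text \<open>Three pairs of parallel half-planes with fixed normals. Suitable bounds degenerate this
  to triangles, truncated triangles and segments, so one compactness and one convexity proof cover
  all figures below.\<close>

definition hexagon :: "real \<Rightarrow> real \<Rightarrow> real \<Rightarrow> real \<Rightarrow> real \<Rightarrow> real \<Rightarrow> (real \<times> real) set" where
  "hexagon a a' b b' c c' =
     {(x, y). a \<le> x \<and> x \<le> a' \<and> b \<le> y \<and> y \<le> b' \<and> c \<le> x + y \<and> x + y \<le> c'}"

lemma hexagon_eq:
  "hexagon a a' b b' c c' =
     cbox (a, b) (a', b') \<inter> {z. (1, 1) \<bullet> z \<ge> c} \<inter> {z. (1, 1) \<bullet> z \<le> c'}"
  by (auto simp: hexagon_def inner_prod_def mem_box cbox_Pair_eq)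

lemma compact_hexagon: "compact (hexagon a a' b b' c c')"
  unfolding hexagon_eq
  by (intro compact_Int_closed compact_cbox closed_halfspace_ge closed_halfspace_le)

lemma convex_hexagon: "convex (hexagon a a' b b' c c')"
  unfolding hexagon_eq by (intro convex_Int convex_box convex_halfspace_ge convex_halfspace_le)

lemma atLeastAtMost_1_3: "{1..3::nat} = {1, 2, 3}"
  by auto

text \<open>Puts words into a form that simplifies to an explicit set once the three memberships are
  decided.\<close>

lemma filter_three:
  "{m \<in> {i, j, k}. P m} =
     (if P i then {i} else {}) \<union> (if P j then {j} else {}) \<union> (if P k then {k} else {})"
  by auto

lemma subset_three:
  assumes "\<sigma> \<subseteq> {i, j, k}"
  shows "\<sigma> \<in> {{i, j, k}, {i, j}, {i, k}, {j, k}, {i}, {j}, {k}, {}}"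
proof -
  have eq: "\<sigma> = {m \<in> {i, j, k}. m \<in> \<sigma>}"
    using assms by blast
  show ?thesis
    by (subst eq, unfold filter_three, cases "i \<in> \<sigma>"; cases "j \<in> \<sigma>"; cases "k \<in> \<sigma>")
      (simp_all add: insert_commute)
qed

lemma convex_code_3_planar:
  fixes A B D :: "(real \<times> real) set"
  assumes "compact A" "convex A" "compact B" "convex B" "compact D" "convex D"
    and C: "C = range (\<lambda>q. (if q \<in> A then {1} else {}) \<union> (if q \<in> B then {2} else {}) \<union>
      (if q \<in> D then {3} else {}))"
  shows "convex_code 3 C"
proof -
  let ?S = "\<lambda>i::nat. if i = 1 then A else if i = 2 then B else D"
  have "closed_convex_code 3 (range (\<lambda>q. {i \<in> {1..3}. q \<in> ?S i}))"
    using assms(1-6) by (intro closed_convex_code_planar) simp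
  moreover have "range (\<lambda>q. {i \<in> {1..3}. q \<in> ?S i}) = C"
    unfolding C atLeastAtMost_1_3 filter_three by simp
  ultimately show ?thesis
    by (simp add: convex_code_def)
qed

text \<open>The triangle \<open>x, y \<ge> 0\<close>, \<open>x + y \<le> 3\<close> with one corner cut off for each index.\<close>

lemma convex_code_C1: "convex_code 3 C1"
proof (rule convex_code_3_planar)
  let ?A = "hexagon 0 2 0 3 0 3" and ?B = "hexagon 0 3 0 2 0 3" and ?D = "hexagon 0 3 0 3 1 3"
  let ?w = "\<lambda>q. (if q \<in> ?A then {1::nat} else {}) \<union> (if q \<in> ?B then {2} else {}) \<union>
    (if q \<in> ?D then {3} else {})"
  show "C1 = range ?w"
  proof
    have w: "?w (1, 1) = {1,2,3}" "?w (0, 0) = {1,2}" "?w (0, 3) = {1,3}" "?w (3, 0) = {2,3}"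
      "?w (4, 0) = {}"
      by (auto simp: hexagon_def)
    have "C1 = ?w ` {(1, 1), (0, 0), (0, 3), (3, 0), (4, 0)}"
      by (simp only: C1_def image_insert image_empty w)
    also have "\<dots> \<subseteq> range ?w"
      by (intro image_mono subset_UNIV)
    finally show "C1 \<subseteq> range ?w" .
    show "range ?w \<subseteq> C1"
    proof (rule image_subsetI)
      fix q :: "real \<times> real"
      \<comment> \<open>The cut-off corners are pairwise disjoint, so every point of the triangle
        misses at most one set.\<close>
      have "q \<in> ?A \<Longrightarrow> q \<in> ?B \<union> ?D"
        "q \<in> ?B \<Longrightarrow> q \<in> ?A \<union> ?D"
        "q \<in> ?D \<Longrightarrow> q \<in> ?A \<union> ?B"
        by (auto simp: hexagon_def)
      then show "?w q \<in> C1"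
        unfolding C1_def by (cases "q \<in> ?A"; cases "q \<in> ?B"; cases "q \<in> ?D")
          (simp_all add: insert_commute)
    qed
  qed
qed (simp_all add: compact_hexagon convex_hexagon)

text \<open>As for \<open>C\<^sub>1\<close>, with the first set extended beyond the side \<open>x = 0\<close>.\<close>

lemma convex_code_C2: "convex_code 3 C2"
proof (rule convex_code_3_planar)
  let ?A = "hexagon (- 1) 2 0 3 (- 1) 3" and ?B = "hexagon 0 3 0 2 0 3" and ?D = "hexagon 0 3 0 3 1 3"
  let ?w = "\<lambda>q. (if q \<in> ?A then {1::nat} else {}) \<union> (if q \<in> ?B then {2} else {}) \<union>
    (if q \<in> ?D then {3} else {})"
  show "C2 = range ?w"
  proof
    have w: "?w (1, 1) = {1,2,3}" "?w (0, 0) = {1,2}" "?w (0, 3) = {1,3}" "?w (3, 0) = {2,3}"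
      "?w (- 1, 0) = {1}" "?w (4, 0) = {}"
      by (auto simp: hexagon_def)
    have "C2 = ?w ` {(1, 1), (0, 0), (0, 3), (3, 0), (- 1, 0), (4, 0)}"
      by (simp only: C2_def image_insert image_empty w)
    also have "\<dots> \<subseteq> range ?w"
      by (intro image_mono subset_UNIV)
    finally show "C2 \<subseteq> range ?w" .
    show "range ?w \<subseteq> C2"
    proof (rule image_subsetI)
      fix q :: "real \<times> real"
      \<comment> \<open>\<open>?B\<close> and \<open>?D\<close> are unchanged and stay in the
        triangle; only points of \<open>?A\<close> with negative first coordinate are new, and they
        give the word \<open>{1}\<close>.\<close>
      have "q \<in> ?B \<Longrightarrow> q \<in> ?A \<union> ?D"
        "q \<in> ?D \<Longrightarrow> q \<in> ?A \<union> ?B"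
        by (auto simp: hexagon_def)
      then show "?w q \<in> C2"
        unfolding C2_def by (cases "q \<in> ?A"; cases "q \<in> ?B"; cases "q \<in> ?D")
          (simp_all add: insert_commute)
    qed
  qed
qed (simp_all add: compact_hexagon convex_hexagon)

text \<open>The three sides of a triangle.\<close>

lemma convex_code_C3: "convex_code 3 C3"
proof (rule convex_code_3_planar)
  let ?A = "hexagon 0 0 0 3 0 3" and ?B = "hexagon 0 3 0 0 0 3" and ?D = "hexagon 0 3 0 3 3 3"
  let ?w = "\<lambda>q. (if q \<in> ?A then {1::nat} else {}) \<union> (if q \<in> ?B then {2} else {}) \<union>
    (if q \<in> ?D then {3} else {})"
  show "C3 = range ?w"
  proof
    have w: "?w (0, 0) = {1,2}" "?w (0, 3) = {1,3}" "?w (3, 0) = {2,3}"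
      "?w (0, 1) = {1}" "?w (1, 0) = {2}" "?w (1, 2) = {3}" "?w (4, 0) = {}"
      by (auto simp: hexagon_def)
    have "C3 = ?w ` {(0, 0), (0, 3), (3, 0), (0, 1), (1, 0), (1, 2), (4, 0)}"
      by (simp only: C3_def image_insert image_empty w)
    also have "\<dots> \<subseteq> range ?w"
      by (intro image_mono subset_UNIV)
    finally show "C3 \<subseteq> range ?w" .
    show "range ?w \<subseteq> C3"
    proof (rule image_subsetI)
      fix q :: "real \<times> real"
      \<comment> \<open>\<open>C3\<close> contains every word except \<open>{1,2,3}\<close>, and the
        three sides have no common point.\<close>
      have "q \<notin> ?A \<inter> ?B \<inter> ?D"
        by (auto simp: hexagon_def)
      then show "?w q \<in> C3"
        unfolding C3_def by (cases "q \<in> ?A"; cases "q \<in> ?B"; cases "q \<in> ?D")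
          (simp_all add: insert_commute)
    qed
  qed
qed (simp_all add: compact_hexagon convex_hexagon)

section \<open>Box obstructions\<close>

lemma nonempty_axis_boxE:
  assumes "axis_box d S" "S \<noteq> {}"
  obtains a b where "S = {x \<in> topspace (Euclidean_space d). \<forall>i<d. a i \<le> x i \<and> x i \<le> b i}"
  using assms by (auto simp: axis_box_def)

lemma axis_box_subset: "axis_box d S \<Longrightarrow> S \<subseteq> topspace (Euclidean_space d)"
  by (auto simp: axis_box_def)

text \<open>Each box contains two of the points \<open>p\<close>, \<open>q\<close>,
  \<open>r\<close>, and the median of three reals lies between any two of them; so the median point
  lies in all three boxes.\<close>

lemma axis_box_Helly:
  assumes "axis_box d A" "axis_box d B" "axis_box d C"
    and "p \<in> A \<inter> B" "q \<in> A \<inter> C" "r \<in> B \<inter> C"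
  shows "A \<inter> B \<inter> C \<noteq> {}"
proof -
  obtain a a' where A: "A = {x \<in> topspace (Euclidean_space d). \<forall>i<d. a i \<le> x i \<and> x i \<le> a' i}"
    using nonempty_axis_boxE[OF assms(1)] assms by blast
  obtain b b' where B: "B = {x \<in> topspace (Euclidean_space d). \<forall>i<d. b i \<le> x i \<and> x i \<le> b' i}"
    using nonempty_axis_boxE[OF assms(2)] assms by blast
  obtain c c' where C: "C = {x \<in> topspace (Euclidean_space d). \<forall>i<d. c i \<le> x i \<and> x i \<le> c' i}"
    using nonempty_axis_boxE[OF assms(3)] assms by blast
  let ?m = "\<lambda>i. max (min (p i) (q i)) (min (max (p i) (q i)) (r i))"
  \<comment> \<open>the coordinatewise median\<close>
  have "?m \<in> A \<inter> B \<inter> C"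
    using assms(4-6) unfolding A B C topspace_Euclidean_space_iff
    by (simp add: le_max_iff_disj min_le_iff_disj)
  then show ?thesis
    by blast
qed

text \<open>
  Swapping a single coordinate of \<open>r\<close> for that of \<open>p\<close> or \<open>q\<close> shows that one coordinate
  witnesses all three non-memberships; there three intervals would violate betweenness.
\<close>

lemma axis_box_cover_obstruction:
  assumes "axis_box d A" "axis_box d B" "axis_box d C"
    and p: "p \<in> A" "p \<in> B" "p \<notin> C"
    and q: "q \<in> A" "q \<in> C" "q \<notin> B"
    and r: "r \<in> B" "r \<in> C" "r \<notin> A"
    and cover: "B \<subseteq> A \<union> C" "C \<subseteq> A \<union> B"
  shows False
proof -
  obtain a a' where A: "A = {x \<in> topspace (Euclidean_space d). \<forall>i<d. a i \<le> x i \<and> x i \<le> a' i}"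
    using nonempty_axis_boxE[OF assms(1)] p by blast
  obtain b b' where B: "B = {x \<in> topspace (Euclidean_space d). \<forall>i<d. b i \<le> x i \<and> x i \<le> b' i}"
    using nonempty_axis_boxE[OF assms(2)] p by blast
  obtain c c' where C: "C = {x \<in> topspace (Euclidean_space d). \<forall>i<d. c i \<le> x i \<and> x i \<le> c' i}"
    using nonempty_axis_boxE[OF assms(3)] q by blast
  obtain i where i: "i < d" "\<not> (a i \<le> r i \<and> r i \<le> a' i)"
    using r unfolding A B by auto
  obtain j where j: "j < d" "\<not> (c j \<le> p j \<and> p j \<le> c' j)"
    using p unfolding B C by auto
  obtain k where k: "k < d" "\<not> (b k \<le> q k \<and> q k \<le> b' k)"
    using q unfolding B C by auto
  \<comment> \<open>Otherwise \<open>r\<close> with coordinate \<open>j\<close> taken from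
    \<open>p\<close> stays in \<open>B\<close>, leaves \<open>C\<close> through coordinate
    \<open>j\<close> and still misses \<open>A\<close> at coordinate \<open>i\<close>, against
    \<open>B \<subseteq> A \<union> C\<close>.\<close>
  have "j = i"
  proof (rule ccontr)
    assume "j \<noteq> i"
    have "r(j := p j) \<in> B"
      using p r j(1) unfolding B topspace_Euclidean_space_iff by auto
    moreover have "r(j := p j) \<notin> C"
      using j unfolding C by auto
    moreover have "r(j := p j) \<notin> A"
      using i \<open>j \<noteq> i\<close> unfolding A by auto
    ultimately show False
      using cover by blast
  qed
  moreover have "k = i"
  proof (rule ccontr)
    assume "k \<noteq> i"
    have "r(k := q k) \<in> C"
      using q r k(1) unfolding C topspace_Euclidean_space_iff by auto
    moreover have "r(k := q k) \<notin> B"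
      using k unfolding B by auto
    moreover have "r(k := q k) \<notin> A"
      using i \<open>k \<noteq> i\<close> unfolding A by auto
    ultimately show False
      using cover by blast
  qed
  \<comment> \<open>In coordinate \<open>i\<close> each interval contains exactly two of the values
    \<open>p i\<close>, \<open>q i\<close>, \<open>r i\<close>. The middle value lies in the
    interval around the other two, a contradiction.\<close>
  moreover have "a i \<le> p i" "p i \<le> a' i" "b i \<le> p i" "p i \<le> b' i"
    "a i \<le> q i" "q i \<le> a' i" "c i \<le> q i" "q i \<le> c' i"
    "b i \<le> r i" "r i \<le> b' i" "c i \<le> r i" "r i \<le> c' i"
    using p q r i(1) unfolding A B C by auto
  ultimately show False
    using i j k by auto
qed

lemma box_convex_code_realization:
  "box_convex_code n C \<Longrightarrow>
    \<exists>d U. realization n d U C \<and> C = code_of n d U \<and> (\<forall>i\<in>{1..n}. axis_box d (U i))"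
  by (auto simp: box_convex_code_def realization_def)

lemma mem_code_of_3:
  assumes "\<sigma> \<subseteq> {1, 2, 3}"
  shows "\<sigma> \<in> code_of 3 d U \<longleftrightarrow> (\<exists>p \<in> topspace (Euclidean_space d).
    (p \<in> U 1 \<longleftrightarrow> 1 \<in> \<sigma>) \<and> (p \<in> U 2 \<longleftrightarrow> 2 \<in> \<sigma>) \<and> (p \<in> U 3 \<longleftrightarrow> 3 \<in> \<sigma>))"
  using assms unfolding code_of_def atLeastAtMost_1_3 by simp

text \<open>The missing words \<open>{2}\<close> and \<open>{3}\<close> say that \<open>U 2\<close>
  and \<open>U 3\<close> are each covered by the other two boxes. This treats \<open>C1\<close> and
  \<open>C2\<close> together, which differ only in \<open>{1}\<close>.\<close>

lemma not_box_convex_code_cover: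
  assumes "{1,2} \<in> C" "{1,3} \<in> C" "{2,3} \<in> C" "{2} \<notin> C" "{3} \<notin> C"
  shows "\<not> box_convex_code 3 C"
proof
  assume "box_convex_code 3 C"
  then obtain d U where C: "C = code_of 3 d U" and box: "\<forall>i\<in>{1..3}. axis_box d (U i)"
    using box_convex_code_realization by blast
  have sub: "U 2 \<subseteq> topspace (Euclidean_space d)" "U 3 \<subseteq> topspace (Euclidean_space d)"
    using box axis_box_subset by auto
  obtain p where p: "p \<in> U 1" "p \<in> U 2" "p \<notin> U 3"
    using assms(1) unfolding C by (subst (asm) mem_code_of_3) auto
  obtain q where q: "q \<in> U 1" "q \<in> U 3" "q \<notin> U 2"
    using assms(2) unfolding C by (subst (asm) mem_code_of_3) auto
  obtain r where r: "r \<in> U 2" "r \<in> U 3" "r \<notin> U 1"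
    using assms(3) unfolding C by (subst (asm) mem_code_of_3) auto
  have "U 2 \<subseteq> U 1 \<union> U 3"
    using assms(4) sub unfolding C by (subst (asm) mem_code_of_3) auto
  moreover have "U 3 \<subseteq> U 1 \<union> U 2"
    using assms(5) sub unfolding C by (subst (asm) mem_code_of_3) auto
  ultimately show False
    using axis_box_cover_obstruction[of d "U 1" "U 2" "U 3" p q r] p q r box by auto
qed

lemma not_box_convex_code_hollow:
  assumes "{1,2} \<in> C" "{1,3} \<in> C" "{2,3} \<in> C" "{1,2,3} \<notin> C"
  shows "\<not> box_convex_code 3 C"
proof
  assume "box_convex_code 3 C"
  then obtain d U where C: "C = code_of 3 d U" and box: "\<forall>i\<in>{1..3}. axis_box d (U i)"
    using box_convex_code_realization by blast
  obtain p where p: "p \<in> U 1 \<inter> U 2"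
    using assms(1) unfolding C by (subst (asm) mem_code_of_3) auto
  obtain q where q: "q \<in> U 1 \<inter> U 3"
    using assms(2) unfolding C by (subst (asm) mem_code_of_3) auto
  obtain r where r: "r \<in> U 2 \<inter> U 3"
    using assms(3) unfolding C by (subst (asm) mem_code_of_3) auto
  have "U 1 \<inter> U 2 \<inter> U 3 \<noteq> {}"
    using axis_box_Helly[of d "U 1" "U 2" "U 3"] p q r box by auto
  moreover have "U 1 \<subseteq> topspace (Euclidean_space d)"
    using box axis_box_subset by auto
  ultimately show False
    using assms(4) unfolding C by (subst (asm) mem_code_of_3) auto
qed

section \<open>Box realizations\<close>

lemma bounded_fun_axis_box:
  assumes "axis_box d S"
  shows "bounded_fun d S"
proof (cases "S = {}")
  case True
  then show ?thesis by (simp add: bounded_fun_def)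
next
  case False
  then obtain a b where S: "S = {x \<in> topspace (Euclidean_space d). \<forall>i<d. a i \<le> x i \<and> x i \<le> b i}"
    using nonempty_axis_boxE[OF assms] by blast
  have "L2_set x {..<d} \<le> (\<Sum>i<d. \<bar>a i\<bar> + \<bar>b i\<bar>)" if "x \<in> S" for x
  proof -
    have "L2_set x {..<d} \<le> (\<Sum>i<d. \<bar>x i\<bar>)"
      by (rule L2_set_le_sum_abs)
    also have "\<dots> \<le> (\<Sum>i<d. \<bar>a i\<bar> + \<bar>b i\<bar>)"
    proof (rule sum_mono)
      fix i assume "i \<in> {..<d}"
      then have "a i \<le> x i" "x i \<le> b i"
        using that S by auto
      then show "\<bar>x i\<bar> \<le> \<bar>a i\<bar> + \<bar>b i\<bar>"
        by linarith
    qed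
    finally show ?thesis .
  qed
  then show ?thesis
    unfolding bounded_fun_def by blast
qed

text \<open>\<open>x(d := 0)\<close> projects onto the first \<open>d\<close> coordinates, since
  points of \<open>Euclidean_space d\<close> vanish from index \<open>d\<close> on. An inverted
  interval \<open>h < l\<close> yields the empty box.\<close>

lemma axis_box_Suc:
  assumes "axis_box d S"
  shows "axis_box (Suc d)
    {x \<in> topspace (Euclidean_space (Suc d)). x(d := 0) \<in> S \<and> l \<le> x d \<and> x d \<le> h}"
    (is "axis_box _ ?T")
proof (cases "S = {} \<or> h < l")
  case True
  then have "?T = {}" by auto
  then show ?thesis by (simp add: axis_box_def)
next
  case False
  then obtain a b where ab: "\<forall>i<d. a i \<le> b i"
    and S: "S = {x \<in> topspace (Euclidean_space d). \<forall>i<d. x i \<in> {a i..b i}}"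
    using assms by (auto simp: axis_box_def)
  have "\<forall>i<Suc d. (a(d := l)) i \<le> (b(d := h)) i"
    using ab False by (auto simp: less_Suc_eq)
  moreover have "?T = {x \<in> topspace (Euclidean_space (Suc d)).
      \<forall>i<Suc d. x i \<in> {(a(d := l)) i..(b(d := h)) i}}"
    unfolding S topspace_Euclidean_space_iff by (auto simp: less_Suc_eq)
  ultimately show ?thesis
    unfolding axis_box_def by blast
qed

text \<open>The source of all box realizations below: each box is multiplied by its own interval in
  a new coordinate \<open>t\<close>. The slice at height \<open>t\<close> shows the words of
  \<open>W\<close> restricted to the indices whose interval contains \<open>t\<close>.\<close>

lemma box_convex_code_product:
  fixes l h :: "nat \<Rightarrow> real"
  assumes "\<And>i. i \<in> {1..n} \<Longrightarrow> axis_box d (W i)"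
  shows "box_convex_code n
    {{i \<in> {1..n}. p \<in> W i \<and> l i \<le> t \<and> t \<le> h i} | p t. p \<in> topspace (Euclidean_space d)}"
    (is "box_convex_code n ?C")
proof -
  define U where "U i =
    {x \<in> topspace (Euclidean_space (Suc d)). x(d := 0) \<in> W i \<and> l i \<le> x d \<and> x d \<le> h i}" for i
  have box: "axis_box (Suc d) (U i)" if "i \<in> {1..n}" for i
    unfolding U_def using assms that by (intro axis_box_Suc)
  have "code_of n (Suc d) U = ?C"
  proof (intro set_eqI iffI)
    fix \<sigma> assume "\<sigma> \<in> code_of n (Suc d) U"
    then obtain x where x: "x \<in> topspace (Euclidean_space (Suc d))"
      and "\<sigma> = {i \<in> {1..n}. x \<in> U i}"
      unfolding code_of_eq_image by blast
    moreover have "x(d := 0) \<in> topspace (Euclidean_space d)"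
      using x by (auto simp: topspace_Euclidean_space_iff)
    ultimately have "\<sigma> = {i \<in> {1..n}. x(d := 0) \<in> W i \<and> l i \<le> x d \<and> x d \<le> h i}"
      by (auto simp: U_def)
    with \<open>x(d := 0) \<in> _\<close> show "\<sigma> \<in> ?C"
      by blast
  next
    fix \<sigma> assume "\<sigma> \<in> ?C"
    then obtain p t where p: "p \<in> topspace (Euclidean_space d)"
      and \<sigma>: "\<sigma> = {i \<in> {1..n}. p \<in> W i \<and> l i \<le> t \<and> t \<le> h i}"
      by blast
    have "p(d := 0) = p"
      using p by (auto simp: topspace_Euclidean_space_iff)
    moreover have top: "p(d := t) \<in> topspace (Euclidean_space (Suc d))"
      using p by (auto simp: topspace_Euclidean_space_iff)
    ultimately have "\<sigma> = {i \<in> {1..n}. p(d := t) \<in> U i}"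
      unfolding \<sigma> by (auto simp: U_def)
    with top show "\<sigma> \<in> code_of n (Suc d) U"
      unfolding code_of_eq_image by blast
  qed
  then have "realization n (Suc d) U ?C"
    using box bounded_fun_axis_box axis_box_subset unfolding realization_def by auto
  then show ?thesis
    using box unfolding box_convex_code_def by blast
qed

text \<open>\<open>Euclidean_space 0\<close> is a single point, so its product with intervals is a
  configuration on a line, of dimension \<open>Suc 0\<close>.\<close>

lemma box_convex_code_intervals:
  "box_convex_code n (range (\<lambda>t::real. {i \<in> {1..n}. l i \<le> t \<and> t \<le> h i}))"
proof -
  have "axis_box 0 (topspace (Euclidean_space 0))"
    by (auto simp: axis_box_def)
  from box_convex_code_product[where W = "\<lambda>_. topspace (Euclidean_space 0)", OF this, of n l h]
  have "box_convex_code n {{i \<in> {1..n}. p \<in> topspace (Euclidean_space 0) \<and> l i \<le> t \<and> t \<le> h i}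
      | p t. p \<in> topspace (Euclidean_space 0)}" .
  moreover have "(\<lambda>_. 0) \<in> topspace (Euclidean_space 0)"
    by (simp add: topspace_Euclidean_space_iff)
  then have "{{i \<in> {1..n}. p \<in> topspace (Euclidean_space 0) \<and> l i \<le> t \<and> t \<le> h i}
      | p t. p \<in> topspace (Euclidean_space 0)} =
    range (\<lambda>t. {i \<in> {1..n}. l i \<le> t \<and> t \<le> h i})"
    by auto
  ultimately show ?thesis
    by simp
qed

text \<open>Boxes with index in \<open>S\<close> are thickened to heights \<open>[0, 1]\<close>, the
  others stay at height 0. The slice \<open>t = 0\<close> shows \<open>C\<close>, those with
  \<open>0 < t \<le> 1\<close> show the words \<open>\<sigma> \<inter> S\<close>, and the rest show
  the empty word, already in \<open>C\<close>.\<close>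

lemma box_convex_code_Un_restrict:
  assumes "box_convex_code n C"
  shows "box_convex_code n (C \<union> (\<lambda>\<sigma>. \<sigma> \<inter> S) ` C)"
proof -
  obtain d U where real: "realization n d U C" and C: "C = code_of n d U"
    and box: "\<forall>i\<in>{1..n}. axis_box d (U i)"
    using box_convex_code_realization[OF assms] by blast
  let ?T = "topspace (Euclidean_space d)"
  define h :: "nat \<Rightarrow> real" where "h i = (if i \<in> S then 1 else 0)" for i
  let ?w = "\<lambda>p t. {i \<in> {1..n}. p \<in> U i \<and> 0 \<le> t \<and> t \<le> h i}"
  let ?v = "\<lambda>p. {i \<in> {1..n}. p \<in> U i}"
  have w: "?w p t = (if t = 0 then ?v p else if 0 < t \<and> t \<le> 1 then ?v p \<inter> S else {})" for p t
    by (auto simp: h_def split: if_splits)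
  have C': "C = ?v ` ?T"
    unfolding C code_of_eq_image ..
  have "{?w p t | p t. p \<in> ?T} = C \<union> (\<lambda>\<sigma>. \<sigma> \<inter> S) ` C"
  proof
    show "{?w p t | p t. p \<in> ?T} \<subseteq> C \<union> (\<lambda>\<sigma>. \<sigma> \<inter> S) ` C"
      unfolding w using empty_in_realization[OF real] C' by auto
    have "?v p = ?w p 0" "?v p \<inter> S = ?w p 1" for p
      unfolding w by auto
    then show "C \<union> (\<lambda>\<sigma>. \<sigma> \<inter> S) ` C \<subseteq> {?w p t | p t. p \<in> ?T}"
      unfolding C' by blast
  qed
  then show ?thesis
    using box_convex_code_product[of n d U "\<lambda>_. 0" h] box by simp
qed

lemma box_convex_code_insert_new:
  assumes "box_convex_code n C" "i \<in> {1..n}" "i \<notin> \<Union>C"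
  shows "box_convex_code n (insert {i} C)"
proof -
  obtain d U where real: "realization n d U C" and C: "C = code_of n d U"
    and box: "\<forall>i\<in>{1..n}. axis_box d (U i)"
    using box_convex_code_realization[OF assms(1)] by blast
  let ?T = "topspace (Euclidean_space d)"
  let ?v = "\<lambda>p. {j \<in> {1..n}. p \<in> U j}"
  define h :: "nat \<Rightarrow> real" where "h j = (if j = i then 1 else 0)" for j
  define W where "W = U(i := {\<lambda>_. 0})"
  let ?w = "\<lambda>p t. {j \<in> {1..n}. p \<in> W j \<and> h j \<le> t \<and> t \<le> h j}"
  have C': "C = ?v ` ?T"
    unfolding C code_of_eq_image ..
  have "p \<notin> U i" if "p \<in> ?T" for p
    using that assms(2,3) C' by auto
  then have w: "?w p t = (if t = 0 then ?v p else if t = 1 \<and> p = (\<lambda>_. 0) then {i} else {})"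
    if "p \<in> ?T" for p t
    using that assms(2) by (auto simp: h_def W_def split: if_splits)
  have zero: "(\<lambda>_. 0) \<in> ?T"
    by (simp add: topspace_Euclidean_space_iff)
  have "{?w p t | p t. p \<in> ?T} = insert {i} C"
  proof
    show "{?w p t | p t. p \<in> ?T} \<subseteq> insert {i} C"
    proof clarify
      fix p t assume p: "p \<in> ?T" and "?w p t \<notin> C"
      moreover have "?v p \<in> C" "{} \<in> C"
        using p C' empty_in_realization[OF real] by blast+
      ultimately have "?w p t \<noteq> ?v p" "?w p t \<noteq> {}"
        by metis+
      then show "?w p t = {i}"
        using w[OF p, of t] by presburger
    qed
    have "?v p = ?w p 0" if "p \<in> ?T" for p
      using w[OF that, of 0] by auto
    moreover have "{i} = ?w (\<lambda>_. 0) 1"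
      using w[OF zero, of 1] by auto
    ultimately show "insert {i} C \<subseteq> {?w p t | p t. p \<in> ?T}"
      unfolding C' using zero by blast
  qed
  moreover have "x = (\<lambda>_. 0) \<longleftrightarrow> x \<in> ?T \<and> (\<forall>i<d. x i \<in> {0..0})" for x
    unfolding topspace_Euclidean_space_iff fun_eq_iff by simp (metis not_le)
  then have "{\<lambda>_. 0} = {x \<in> ?T. \<forall>i<d. x i \<in> {0..0}}"
    by (intro set_eqI) (simp only: singleton_iff mem_Collect_eq)
  then have "axis_box d {\<lambda>_. 0}"
    unfolding axis_box_def by (intro disjI2 exI[of _ "\<lambda>_. 0"]) simp
  then have "axis_box d (W j)" if "j \<in> {1..n}" for j
    using box that by (auto simp: W_def)
  ultimately show ?thesis
    using box_convex_code_product[of n d W h h] by simp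
qed

text \<open>If \<open>i\<close> occurs in some word, restricting to \<open>{i}\<close> adds only
  \<open>{i}\<close> and the empty word.\<close>

lemma box_convex_code_insert_singleton:
  assumes "box_convex_code n C" "i \<in> {1..n}"
  shows "box_convex_code n (insert {i} C)"
proof (cases "i \<in> \<Union>C")
  case True
  have absorb: "C \<union> D = insert {i} C" if "{i} \<in> D" "D \<subseteq> {{i}, {}}" "{} \<in> C" for D
    using that by auto
  have "{i} \<in> (\<lambda>\<sigma>. \<sigma> \<inter> {i}) ` C"
    using True by force
  moreover have "(\<lambda>\<sigma>. \<sigma> \<inter> {i}) ` C \<subseteq> {{i}, {}}"
    by blast
  moreover have "{} \<in> C"
    using assms(1) empty_in_realization unfolding box_convex_code_def by blast
  ultimately have "C \<union> (\<lambda>\<sigma>. \<sigma> \<inter> {i}) ` C = insert {i} C"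
    by (rule absorb)
  then show ?thesis
    using box_convex_code_Un_restrict[OF assms(1), of "{i}"] by simp
next
  case False
  then show ?thesis
    using box_convex_code_insert_new assms by blast
qed

text \<open>Singletons can be adjoined but not removed, so it suffices to realize a base code with
  the right words of size at least two and few enough singletons.\<close>

lemma box_convex_code_add_singletons:
  assumes "box_convex_code n B" "B \<subseteq> C" "C \<subseteq> B \<union> (\<lambda>i. {i}) ` {1..n}"
  shows "box_convex_code n C"
proof -
  have add: "box_convex_code n (B \<union> (\<lambda>i. {i}) ` V)" if "finite V" "V \<subseteq> {1..n}" for V
    using that
  proof (induction V)
    case empty
    then show ?case using assms(1) by simp
  next
    case (insert v V)
    then show ?case
      using box_convex_code_insert_singleton[of n "B \<union> (\<lambda>i. {i}) ` V" v] by simp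
  qed
  define V where "V = {i \<in> {1..n}. {i} \<in> C}"
  have "C = B \<union> (\<lambda>i. {i}) ` V"
    using assms(2,3) unfolding V_def by blast
  moreover have "box_convex_code n (B \<union> (\<lambda>i. {i}) ` V)"
    by (rule add) (auto simp: V_def)
  ultimately show ?thesis
    by metis
qed

section \<open>Base codes on three indices, in an arbitrary labelling\<close>

context
  fixes n i j k :: nat
  assumes ijk: "{1..n} = {i, j, k}" "i \<noteq> j" "i \<noteq> k" "j \<noteq> k"
begin

lemma box_convex_code_intervals_three:
  assumes "C = range (\<lambda>t::real. {m \<in> {i, j, k}. l m \<le> t \<and> t \<le> h m})"
  shows "box_convex_code n C"
  using box_convex_code_intervals[of n l h] unfolding assms ijk(1) .

lemma box_convex_code_edgeless: "box_convex_code n {{}}"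
  by (rule box_convex_code_intervals_three[where l = "\<lambda>_. 1" and h = "\<lambda>_. 0"]) auto

lemma box_convex_code_simplex: "box_convex_code n {{i, j, k}, {}}"
proof (rule box_convex_code_intervals_three[where l = "\<lambda>_. 0" and h = "\<lambda>_. 0"])
  let ?w = "\<lambda>t::real. {m \<in> {i, j, k}. 0 \<le> t \<and> t \<le> 0}"
  have "?w 0 = {i, j, k}" "?w 1 = {}" by auto
  then show "{{i, j, k}, {}} = range ?w"
    by (auto intro: range_eqI[of _ _ 0] range_eqI[of _ _ 1])
qed

lemma box_convex_code_simplex_edge: "box_convex_code n {{i, j, k}, {i, j}, {}}"
proof -
  have w: "{i, j, k} \<inter> {i, j} = {i, j}" "{} \<inter> {i, j} = {}"
    by auto
  have "{{i, j, k}, {}} \<union> (\<lambda>\<sigma>. \<sigma> \<inter> {i, j}) ` {{i, j, k}, {}} = {{i, j, k}, {i, j}, {}}"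
    by (simp only: image_insert image_empty w Un_insert_left Un_empty_left insert_commute insert_absorb2)
  then show ?thesis
    using box_convex_code_Un_restrict[OF box_convex_code_simplex, of "{i, j}"] by simp
qed

text \<open>Sets \<open>i\<close> and \<open>j\<close> are the point 0; the inverted interval
  \<open>[1, 0]\<close> makes set \<open>k\<close> empty.\<close>

lemma box_convex_code_edge: "box_convex_code n {{i, j}, {}}"
proof (rule box_convex_code_intervals_three
    [where l = "\<lambda>m. if m = k then 1 else 0" and h = "\<lambda>_. 0"])
  let ?w = "\<lambda>t::real. {m \<in> {i, j, k}. (if m = k then 1 else 0) \<le> t \<and> t \<le> 0}"
  have w: "?w 0 = {i, j}" "?w 1 = {}"
    using ijk(2-4) by auto
  have word: "?w t = (if t = 0 then {i, j} else {})" for t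
    using ijk(2-4) by auto
  have "{{i, j}, {}} = ?w ` {0, 1}"
    by (simp only: image_insert image_empty w)
  also have "\<dots> \<subseteq> range ?w"
    by (intro image_mono subset_UNIV)
  finally have "{{i, j}, {}} \<subseteq> range ?w" .
  moreover have "range ?w \<subseteq> {{i, j}, {}}"
    by (simp only: image_subset_iff word split: if_split) simp
  ultimately show "{{i, j}, {}} = range ?w" ..
qed

text \<open>The intervals are \<open>[0, 3]\<close>, \<open>[0, 2]\<close>, \<open>[1, 3]\<close>
  for \<open>i\<close>, \<open>j\<close>, \<open>k\<close>. The last two overlap and cover the
  first, so no singleton arises.\<close>

lemma box_convex_code_simplex_path: "box_convex_code n {{i, j, k}, {i, j}, {i, k}, {}}"
proof (rule box_convex_code_intervals_three
    [where l = "\<lambda>m. if m = k then 1 else 0" and h = "\<lambda>m. if m = j then 2 else 3"])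
  let ?w = "\<lambda>t::real. {m \<in> {i, j, k}. (if m = k then 1 else 0) \<le> t \<and> t \<le> (if m = j then 2 else 3)}"
  have w: "?w 1 = {i, j, k}" "?w 0 = {i, j}" "?w 3 = {i, k}" "?w 4 = {}"
    using ijk(2-4) by auto
  have word: "?w t = (if t < 0 \<or> 3 < t then {}
      else if t < 1 then {i, j} else if t \<le> 2 then {i, j, k} else {i, k})" for t
    using ijk(2-4) by auto
  have "{{i, j, k}, {i, j}, {i, k}, {}} = ?w ` {1, 0, 3, 4}"
    by (simp only: image_insert image_empty w)
  also have "\<dots> \<subseteq> range ?w"
    by (intro image_mono subset_UNIV)
  finally have "{{i, j, k}, {i, j}, {i, k}, {}} \<subseteq> range ?w" .
  moreover have "range ?w \<subseteq> {{i, j, k}, {i, j}, {i, k}, {}}"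
    by (simp only: image_subset_iff word split: if_split) simp
  ultimately show "{{i, j, k}, {i, j}, {i, k}, {}} = range ?w" ..
qed

text \<open>Sets \<open>j\<close> and \<open>k\<close> are the endpoints of the interval
  \<open>[0, 2]\<close> of \<open>i\<close>; the gap between them gives the word
  \<open>{i}\<close>.\<close>

lemma box_convex_code_path: "box_convex_code n {{i, j}, {i, k}, {i}, {}}"
proof (rule box_convex_code_intervals_three
    [where l = "\<lambda>m. if m = k then 2 else 0" and h = "\<lambda>m. if m = j then 0 else 2"])
  let ?w = "\<lambda>t::real. {m \<in> {i, j, k}. (if m = k then 2 else 0) \<le> t \<and> t \<le> (if m = j then 0 else 2)}"
  have w: "?w 0 = {i, j}" "?w 2 = {i, k}" "?w 1 = {i}" "?w 4 = {}"
    using ijk(2-4) by auto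
  have word: "?w t = (if t < 0 \<or> 2 < t then {}
      else if t = 0 then {i, j} else if t < 2 then {i} else {i, k})" for t
    using ijk(2-4) by auto
  have "{{i, j}, {i, k}, {i}, {}} = ?w ` {0, 2, 1, 4}"
    by (simp only: image_insert image_empty w)
  also have "\<dots> \<subseteq> range ?w"
    by (intro image_mono subset_UNIV)
  finally have "{{i, j}, {i, k}, {i}, {}} \<subseteq> range ?w" .
  moreover have "range ?w \<subseteq> {{i, j}, {i, k}, {i}, {}}"
    by (simp only: image_subset_iff word split: if_split) simp
  ultimately show "{{i, j}, {i, k}, {i}, {}} = range ?w" ..
qed

text \<open>Restricting the path to \<open>{j, k}\<close> creates the third edge from
  \<open>{i, j, k}\<close>, at the price of the two singletons cut out of \<open>{i, j}\<close> and
  \<open>{i, k}\<close>.\<close>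

lemma box_convex_code_simplex_triangle:
  "box_convex_code n {{i, j, k}, {i, j}, {i, k}, {j, k}, {j}, {k}, {}}"
proof -
  let ?C = "{{i, j, k}, {i, j}, {i, k}, {}}"
  have w: "{i, j, k} \<inter> {j, k} = {j, k}" "{i, j} \<inter> {j, k} = {j}" "{i, k} \<inter> {j, k} = {k}"
    "{} \<inter> {j, k} = {}"
    using ijk by auto
  have "?C \<union> (\<lambda>\<sigma>. \<sigma> \<inter> {j, k}) ` ?C = {{i, j, k}, {i, j}, {i, k}, {j, k}, {j}, {k}, {}}"
    by (simp only: image_insert image_empty w Un_insert_left Un_empty_left insert_commute insert_absorb2)
  then show ?thesis
    using box_convex_code_Un_restrict[OF box_convex_code_simplex_path, of "{j, k}"] by simp
qed

end

text \<open>Without \<open>{j, k}\<close> only \<open>{i, j}\<close>, \<open>{i, k}\<close> and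
  \<open>{i, j, k}\<close> can occur as larger words, and each of the eight combinations has a base
  code. Hence a convex code that is not box-convex contains all three edges.\<close>

lemma box_convex_code_missing_edge:
  assumes ijk: "{1..n} = {i, j, k}" "i \<noteq> j" "i \<noteq> k" "j \<noteq> k"
    and C: "C \<subseteq> Pow {1..n}" "{} \<in> C" "{j, k} \<notin> C"
    and vertex: "{i, j} \<in> C \<Longrightarrow> {i, k} \<in> C \<Longrightarrow> {i, j, k} \<notin> C \<Longrightarrow> {i} \<in> C"
  shows "box_convex_code n C"
proof -
  have ikj: "{1..n} = {i, k, j}"
    using ijk(1) by blast
  have edge: "\<sigma> \<in> (\<lambda>i. {i}) ` {1..n} \<or> \<sigma> \<in> {{}, {i, j}, {i, k}, {i, j, k}}" if "\<sigma> \<in> C" for \<sigma>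
  proof -
    have "\<sigma> \<subseteq> {i, j, k}"
      using that C(1) ijk(1) by auto
    then have "\<sigma> \<in> {{i, j, k}, {i, j}, {i, k}, {j, k}, {i}, {j}, {k}, {}}"
      by (rule subset_three)
    then show ?thesis
      using that C(3) unfolding ijk(1) by fast
  qed
  have add: "box_convex_code n C" if "box_convex_code n B" "B \<subseteq> C" "{} \<in> B"
    "\<And>\<sigma>. \<sigma> \<in> {{i, j}, {i, k}, {i, j, k}} \<Longrightarrow> \<sigma> \<in> C \<Longrightarrow> \<sigma> \<in> B" for B
  proof (rule box_convex_code_add_singletons[OF that(1,2)])
    show "C \<subseteq> B \<union> (\<lambda>i. {i}) ` {1..n}"
    proof
      fix \<sigma> assume \<sigma>: "\<sigma> \<in> C"
      show "\<sigma> \<in> B \<union> (\<lambda>i. {i}) ` {1..n}"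
        using edge[OF \<sigma>]
      proof
        assume "\<sigma> \<in> {{}, {i, j}, {i, k}, {i, j, k}}"
        then have "\<sigma> = {} \<or> \<sigma> \<in> {{i, j}, {i, k}, {i, j, k}}"
          by (simp only: insert_iff)
        then have "\<sigma> \<in> B"
          using that(3) that(4)[OF _ \<sigma>] by metis
        then show ?thesis
          by (rule UnI1)
      qed (rule UnI2)
    qed
  qed
  consider (a) "{i, j, k} \<in> C" "{i, j} \<in> C" "{i, k} \<in> C"
    | (b) "{i, j, k} \<in> C" "{i, j} \<in> C" "{i, k} \<notin> C"
    | (c) "{i, j, k} \<in> C" "{i, j} \<notin> C" "{i, k} \<in> C"
    | (d) "{i, j, k} \<in> C" "{i, j} \<notin> C" "{i, k} \<notin> C"
    | (e) "{i, j, k} \<notin> C" "{i, j} \<in> C" "{i, k} \<in> C"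
    | (f) "{i, j, k} \<notin> C" "{i, j} \<in> C" "{i, k} \<notin> C"
    | (g) "{i, j, k} \<notin> C" "{i, j} \<notin> C" "{i, k} \<in> C"
    | (h) "{i, j, k} \<notin> C" "{i, j} \<notin> C" "{i, k} \<notin> C"
    by argo
  then show ?thesis
  proof cases
    case a
    show ?thesis
      by (rule add[OF box_convex_code_simplex_path[OF ijk]]) (use a C in auto)
  next
    case b
    show ?thesis
      by (rule add[OF box_convex_code_simplex_edge[OF ijk]]) (use b C in auto)
  next
    \<comment> \<open>The base code for a single edge is used with \<open>j\<close> and
      \<open>k\<close> exchanged.\<close>
    case c
    have "{i, k, j} = {i, j, k}"
      by blast
    then have "box_convex_code n {{i, j, k}, {i, k}, {}}"
      using box_convex_code_simplex_edge[OF ikj ijk(3,2) ijk(4)[symmetric]] by simp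
    then show ?thesis
      by (rule add) (use c C in auto)
  next
    case d
    show ?thesis
      by (rule add[OF box_convex_code_simplex[OF ijk]]) (use d C in auto)
  next
    \<comment> \<open>The only base code here that has a singleton, \<open>{i}\<close>; the
      hypothesis \<open>vertex\<close> guarantees that it belongs to \<open>C\<close>.\<close>
    case e
    show ?thesis
      by (rule add[OF box_convex_code_path[OF ijk]]) (use e C vertex in auto)
  next
    case f
    show ?thesis
      by (rule add[OF box_convex_code_edge[OF ijk]]) (use f C in auto)
  next
    case g
    show ?thesis
      by (rule add[OF box_convex_code_edge[OF ikj ijk(3,2) ijk(4)[symmetric]]]) (use g C in auto)
  next
    case h
    show ?thesis
      by (rule add[OF box_convex_code_edgeless[OF ijk]]) (use h C in auto)
  qed
qed

section \<open>Classification\<close>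

lemma box_convex_code_two_vertices:
  assumes ijk: "{1..n} = {i, j, k}" "i \<noteq> j" "i \<noteq> k" "j \<noteq> k"
    and C: "C \<subseteq> Pow {1..n}" "{{i, j, k}, {i, j}, {i, k}, {j, k}, {j}, {k}, {}} \<subseteq> C"
  shows "box_convex_code n C"
proof (rule box_convex_code_add_singletons[OF box_convex_code_simplex_triangle[OF ijk] C(2)])
  show "C \<subseteq> {{i, j, k}, {i, j}, {i, k}, {j, k}, {j}, {k}, {}} \<union> (\<lambda>i. {i}) ` {1..n}"
  proof
    fix \<sigma> assume "\<sigma> \<in> C"
    then have "\<sigma> \<subseteq> {i, j, k}"
      using C(1) ijk(1) by auto
    then have "\<sigma> \<in> {{i, j, k}, {i, j}, {i, k}, {j, k}, {i}, {j}, {k}, {}}"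
      by (rule subset_three)
    then show "\<sigma> \<in> {{i, j, k}, {i, j}, {i, k}, {j, k}, {j}, {k}, {}} \<union> (\<lambda>i. {i}) ` {1..n}"
      unfolding ijk(1) by fast
  qed
qed

lemma perm_equiv_refl: "perm_equiv n C C"
  unfolding perm_equiv_def by (intro exI[of _ id]) (auto simp: permutes_id)

text \<open>The transposition of 1 and \<open>v\<close> moves the distinguished vertex to
  \<open>v\<close> and permutes the three edges among themselves.\<close>

lemma perm_equiv_C2_vertex:
  assumes "v \<in> {1, 2, 3}"
  shows "perm_equiv 3 C2 {{1,2,3}, {1,2}, {1,3}, {2,3}, {v}, {}}"
proof -
  let ?\<pi> = "Transposition.transpose 1 v"
  have "?\<pi> permutes {1..3}"
    using assms by (intro permutes_swap_id) auto
  moreover have "(`) ?\<pi> ` C2 = {{1,2,3}, {1,2}, {1,3}, {2,3}, {v}, {}}"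
    using assms
    by (elim insertE emptyE) (simp_all add: C2_def Transposition.transpose_def insert_commute)
  ultimately show ?thesis
    unfolding perm_equiv_def by metis
qed

lemma convex_not_box_convex_classification:
  assumes "C \<subseteq> Pow {1..3}" "convex_code 3 C" "\<not> box_convex_code 3 C"
  shows "\<exists>D \<in> {C1, C2, C3}. perm_equiv 3 D C"
proof -
  have empty: "{} \<in> C"
    using assms(2) by (rule empty_in_convex_code)
  have swap: "{2, 1} = {1, 2::nat}" "{3, 1} = {1, 3::nat}" "{3, 2} = {2, 3::nat}"
    "{2, 1, 3} = {1, 2, 3::nat}" "{3, 1, 2} = {1, 2, 3::nat}"
    by auto
  \<comment> \<open>The preceding lemmas distinguish their first index \<open>i\<close>, so each is
    used with 1, 2 and 3 in that place; \<open>swap\<close> restores the sorted notation.\<close>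
  have perms: "{1..3::nat} = {1, 2, 3}" "{1..3::nat} = {2, 1, 3}" "{1..3::nat} = {3, 1, 2}"
    by auto
  have vertex: "{1,2} \<in> C \<Longrightarrow> {1,3} \<in> C \<Longrightarrow> {1,2,3} \<notin> C \<Longrightarrow> {1} \<in> C"
    "{1,2} \<in> C \<Longrightarrow> {2,3} \<in> C \<Longrightarrow> {1,2,3} \<notin> C \<Longrightarrow> {2} \<in> C"
    "{1,3} \<in> C \<Longrightarrow> {2,3} \<in> C \<Longrightarrow> {1,2,3} \<notin> C \<Longrightarrow> {3} \<in> C"
    using convex_code_mandatory_vertex[OF assms(2) perms(1)]
      convex_code_mandatory_vertex[OF assms(2) perms(2)]
      convex_code_mandatory_vertex[OF assms(2) perms(3)]
    unfolding swap by simp_all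
  have edges: "{2,3} \<in> C" "{1,3} \<in> C" "{1,2} \<in> C"
    using box_convex_code_missing_edge[OF perms(1) _ _ _ assms(1) empty]
      box_convex_code_missing_edge[OF perms(2) _ _ _ assms(1) empty]
      box_convex_code_missing_edge[OF perms(3) _ _ _ assms(1) empty] vertex assms(3)
    unfolding swap by auto
  \<comment> \<open>Intersecting with the list of all eight words lets simplification compute
    \<open>C\<close> from membership facts alone.\<close>
  have C: "C = {{1,2,3}, {1,2}, {1,3}, {2,3}, {1}, {2}, {3}, {}} \<inter> C"
    using assms(1) unfolding atLeastAtMost_1_3
    by (intro Int_absorb1[symmetric] subsetI subset_three) blast
  show ?thesis
  proof (cases "{1,2,3} \<in> C")
    case False
    \<comment> \<open>With all edges present and \<open>{1,2,3}\<close> absent, connectedness forces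
      all three singletons.\<close>
    have "C = C3"
      by (subst C) (simp only: C3_def Int_insert_left Int_empty_left False edges vertex empty
          not_False_eq_True if_True if_False)
    then show ?thesis
      using perm_equiv_refl by blast
  next
    case True
    \<comment> \<open>Two singletons together with all edges and \<open>{1,2,3}\<close> would make
      \<open>C\<close> box-convex, so at most one singleton remains: none gives \<open>C1\<close>,
      one gives \<open>C2\<close> up to relabelling.\<close>
    have two: "\<not> ({2} \<in> C \<and> {3} \<in> C)" "\<not> ({1} \<in> C \<and> {3} \<in> C)" "\<not> ({1} \<in> C \<and> {2} \<in> C)"
      using box_convex_code_two_vertices[OF perms(1) _ _ _ assms(1)]
        box_convex_code_two_vertices[OF perms(2) _ _ _ assms(1)]
        box_convex_code_two_vertices[OF perms(3) _ _ _ assms(1)] assms(3) True edges empty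
      unfolding swap by auto
    show ?thesis
    proof (cases "\<exists>v \<in> {1, 2, 3}. {v} \<in> C")
      case False
      then have no: "{1} \<notin> C" "{2} \<notin> C" "{3} \<notin> C"
        by blast+
      have "C = C1"
        by (subst C) (simp only: C1_def Int_insert_left Int_empty_left True edges no empty
            if_True if_False)
      then show ?thesis
        using perm_equiv_refl by blast
    next
      case vC: True
      then obtain v where v: "v \<in> {1, 2, 3}" "{v} \<in> C"
        by blast
      have "C = {{1,2,3}, {1,2}, {1,3}, {2,3}, {v}, {}}"
      proof -
        consider "v = 1" "{1} \<in> C" "{2} \<notin> C" "{3} \<notin> C" | "v = 2" "{1} \<notin> C" "{2} \<in> C" "{3} \<notin> C"
          | "v = 3" "{1} \<notin> C" "{2} \<notin> C" "{3} \<in> C"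
          using v two by blast
        then show ?thesis
          by cases (subst C, simp only: Int_insert_left Int_empty_left True edges empty
              if_True if_False)+
      qed
      then show ?thesis
        using perm_equiv_C2_vertex[OF v(1)] by simp
    qed
  qed
qed

lemma card_C1_C2_C3: "card C1 = 5" "card C2 = 6" "card C3 = 7"
  by (auto simp: C1_def C2_def C3_def card_insert_if insert_eq_iff doubleton_eq_iff)

theorem mainTheorem4:
  shows "(\<forall>C \<in> {C1, C2, C3}. C \<subseteq> Pow {1..3} \<and> convex_code 3 C \<and> \<not> box_convex_code 3 C)
    \<and> \<not> perm_equiv 3 C1 C2 \<and> \<not> perm_equiv 3 C1 C3 \<and> \<not> perm_equiv 3 C2 C3
    \<and> (\<forall>C. C \<subseteq> Pow {1..3} \<longrightarrow> convex_code 3 C \<longrightarrow> \<not> box_convex_code 3 C \<longrightarrow>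
          (\<exists>D \<in> {C1, C2, C3}. perm_equiv 3 D C))"
proof (intro conjI ballI allI impI)
  fix C assume C: "C \<in> {C1, C2, C3}"
  then show "C \<subseteq> Pow {1..3}"
    by (auto simp: C1_def C2_def C3_def)
  show "convex_code 3 C"
    using C convex_code_C1 convex_code_C2 convex_code_C3 by blast
  have "\<not> box_convex_code 3 C1" "\<not> box_convex_code 3 C2"
    by (rule not_box_convex_code_cover; simp add: C1_def C2_def insert_eq_iff doubleton_eq_iff)+
  moreover have "\<not> box_convex_code 3 C3"
    by (rule not_box_convex_code_hollow; simp add: C3_def insert_eq_iff doubleton_eq_iff)
  ultimately show "\<not> box_convex_code 3 C"
    using C by blast
next
  show "\<not> perm_equiv 3 C1 C2" "\<not> perm_equiv 3 C1 C3" "\<not> perm_equiv 3 C2 C3"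
    using perm_equiv_card card_C1_C2_C3 by fastforce+
next
  fix C assume "C \<subseteq> Pow {1..3}" "convex_code 3 C" "\<not> box_convex_code 3 C"
  then show "\<exists>D \<in> {C1, C2, C3}. perm_equiv 3 D C"
    by (rule convex_not_box_convex_classification)
qed

end
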